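(* Not every left ideal with a contractive approximate identity in a unital operator algebra is proximinal. That is, there exist a unital operator algebra $A$, a closed left ideal $J$ of $A$ possessing a contractive approximate identity, and an element $b \in A$ such that there is no $y \in J$ with $\Vert b - y \Vert = d(b,J) = \inf\{\Vert b - z\Vert : z \in J\}$.
   Context: An operator algebra is a norm closed algebra of operators on a Hilbert space; it is unital if it has an identity of norm $1$. A contractive approximate identity for $J$ is a net $(e_t)$ in the closed unit ball of $J$ with $e_t x \to x$ and $x e_t \to x$ in norm for all $x \in J$. A subspace $J$ of $A$ is proximinal if for every $x \in A$ the distance $d(x,J)$ is achieved at some point of $J$. *)

theory Defs
  imports "HOL-Analysis.Analysis"
begin

section \<open>Complex Hilbert spaces\<close>

class complex_vector = real_vector +
  fixes scaleC :: "complex \<Rightarrow> 'a \<Rightarrow> 'a" (infixr "*\<^sub>C" 75)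
  assumes scaleC_add_right: "c *\<^sub>C (x + y) = c *\<^sub>C x + c *\<^sub>C y"
    and scaleC_add_left: "(c + d) *\<^sub>C x = c *\<^sub>C x + d *\<^sub>C x"
    and scaleC_scaleC: "c *\<^sub>C d *\<^sub>C x = (c * d) *\<^sub>C x"
    and scaleC_one: "1 *\<^sub>C x = x"
    and scaleR_scaleC: "r *\<^sub>R x = complex_of_real r *\<^sub>C x"

global_interpretation complex_vector: vector_space "scaleC :: complex \<Rightarrow> 'a \<Rightarrow> 'a::complex_vector"
  by standard (simp_all add: scaleC_add_right scaleC_add_left scaleC_scaleC scaleC_one)

text \<open>The inner product is conjugate-linear in its first argument. Its definiteness
  is the definiteness of the norm.\<close>

class complex_inner = complex_vector + real_normed_vector +
  fixes cinner :: "'a \<Rightarrow> 'a \<Rightarrow> complex"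
  assumes cinner_commute: "cinner x y = cnj (cinner y x)"
    and cinner_add_right: "cinner x (y + z) = cinner x y + cinner x z"
    and cinner_scaleC_right: "cinner x (c *\<^sub>C y) = c * cinner x y"
    and cinner_self: "cinner x x = complex_of_real ((norm x)\<^sup>2)"

class complex_hilbert = complex_inner + complete_space

lemma cinner_scaleC_left: "cinner (c *\<^sub>C x) y = cnj c * cinner x y"
  by (subst (1 2) cinner_commute) (simp add: cinner_scaleC_right)

lemma norm_scaleC: "norm (c *\<^sub>C x) = norm c * norm (x :: 'a::complex_inner)"
proof -
  have "complex_of_real ((norm (c *\<^sub>C x))\<^sup>2) = cnj c * c * cinner x x"
    unfolding cinner_self[symmetric] by (simp add: cinner_scaleC_right cinner_scaleC_left)
  also have "\<dots> = complex_of_real ((norm c * norm x)\<^sup>2)"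
    unfolding cinner_self using complex_norm_square[of c] by (simp add: power_mult_distrib mult.commute)
  finally show ?thesis
    by (simp only: of_real_eq_iff) (simp add: power2_eq_iff_nonneg)
qed

lemma bounded_linear_scaleC: "bounded_linear (\<lambda>x :: 'a::complex_inner. c *\<^sub>C x)"
  by (rule bounded_linear_intro[of _ "norm c"])
    (simp_all add: scaleC_add_right scaleR_scaleC scaleC_scaleC mult.commute norm_scaleC)

section \<open>The Hilbert space of square-summable sequences\<close>

typedef ell2 = "{f :: nat \<Rightarrow> complex. summable (\<lambda>k. (norm (f k))\<^sup>2)}"
  by (rule exI[of _ "\<lambda>_. 0"]) simp

setup_lifting type_definition_ell2

lemma ell2_summable_add:
  fixes f g :: "nat \<Rightarrow> complex"
  assumes "summable (\<lambda>k. (norm (f k))\<^sup>2)" "summable (\<lambda>k. (norm (g k))\<^sup>2)"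
  shows "summable (\<lambda>k. (norm (f k + g k))\<^sup>2)"
proof (rule summable_comparison_test')
  show "summable (\<lambda>k. 2 * (norm (f k))\<^sup>2 + 2 * (norm (g k))\<^sup>2)"
    by (intro summable_add summable_mult assms)
  fix k :: nat
  have "(norm (f k + g k))\<^sup>2 \<le> (norm (f k) + norm (g k))\<^sup>2"
    by (intro power_mono norm_triangle_ineq) simp
  also have "\<dots> \<le> 2 * (norm (f k))\<^sup>2 + 2 * (norm (g k))\<^sup>2"
    using zero_le_power2[of "norm (f k) - norm (g k)"] by (simp add: power2_eq_square algebra_simps)
  finally show "norm ((norm (f k + g k))\<^sup>2) \<le> 2 * (norm (f k))\<^sup>2 + 2 * (norm (g k))\<^sup>2"
    by simp
qed

lemma ell2_summable_scale:
  fixes f :: "nat \<Rightarrow> complex"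
  shows "summable (\<lambda>k. (norm (f k))\<^sup>2) \<Longrightarrow> summable (\<lambda>k. (norm (c * f k))\<^sup>2)"
  by (simp add: norm_mult power_mult_distrib)

lemma ell2_summable_cinner:
  fixes f g :: "nat \<Rightarrow> complex"
  assumes "summable (\<lambda>k. (norm (f k))\<^sup>2)" "summable (\<lambda>k. (norm (g k))\<^sup>2)"
  shows "summable (\<lambda>k. cnj (f k) * g k)"
proof (rule summable_comparison_test')
  show "summable (\<lambda>k. (norm (f k))\<^sup>2 + (norm (g k))\<^sup>2)"
    by (intro summable_add assms)
  fix k :: nat
  have "0 \<le> norm (f k) * norm (g k)"
    by simp
  then show "norm (cnj (f k) * g k) \<le> (norm (f k))\<^sup>2 + (norm (g k))\<^sup>2"
    using zero_le_power2[of "norm (f k) - norm (g k)"]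
    unfolding norm_mult complex_mod_cnj power2_diff by linarith
qed

lemma ell2_norm_triangle:
  fixes f g :: "nat \<Rightarrow> complex"
  assumes f: "summable (\<lambda>k. (norm (f k))\<^sup>2)" and g: "summable (\<lambda>k. (norm (g k))\<^sup>2)"
  shows "sqrt (\<Sum>k. (norm (f k + g k))\<^sup>2) \<le> sqrt (\<Sum>k. (norm (f k))\<^sup>2) + sqrt (\<Sum>k. (norm (g k))\<^sup>2)"
    (is "_ \<le> ?F + ?G")
proof -
  have "(\<Sum>k. (norm (f k + g k))\<^sup>2) \<le> (?F + ?G)\<^sup>2"
  proof (rule suminf_le_const[OF ell2_summable_add[OF f g]])
    fix n :: nat
    have "L2_set (\<lambda>k. norm (f k + g k)) {..<n} \<le> L2_set (\<lambda>k. norm (f k) + norm (g k)) {..<n}"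
      by (intro L2_set_mono norm_triangle_ineq) auto
    also have "\<dots> \<le> L2_set (\<lambda>k. norm (f k)) {..<n} + L2_set (\<lambda>k. norm (g k)) {..<n}"
      by (rule L2_set_triangle_ineq)
    also have "\<dots> \<le> ?F + ?G"
      unfolding L2_set_def
      by (intro add_mono real_sqrt_le_mono sum_le_suminf f g) auto
    finally have "(L2_set (\<lambda>k. norm (f k + g k)) {..<n})\<^sup>2 \<le> (?F + ?G)\<^sup>2"
      by (intro power_mono) auto
    then show "(\<Sum>k<n. (norm (f k + g k))\<^sup>2) \<le> (?F + ?G)\<^sup>2"
      by (simp add: L2_set_def sum_nonneg)
  qed
  moreover have "0 \<le> ?F + ?G"
    by (intro add_nonneg_nonneg real_sqrt_ge_zero suminf_nonneg f g) auto
  ultimately show ?thesis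
    using real_le_lsqrt by blast
qed

instantiation ell2 :: complex_inner
begin

lift_definition zero_ell2 :: ell2 is "\<lambda>_. 0" by simp

lift_definition plus_ell2 :: "ell2 \<Rightarrow> ell2 \<Rightarrow> ell2" is "\<lambda>f g k. f k + g k"
  by (rule ell2_summable_add)

lift_definition uminus_ell2 :: "ell2 \<Rightarrow> ell2" is "\<lambda>f k. - f k" by simp

lift_definition minus_ell2 :: "ell2 \<Rightarrow> ell2 \<Rightarrow> ell2" is "\<lambda>f g k. f k - g k"
  using ell2_summable_add[of _ "\<lambda>k. - _ k"] by simp

lift_definition scaleC_ell2 :: "complex \<Rightarrow> ell2 \<Rightarrow> ell2" is "\<lambda>c f k. c * f k"
  by (rule ell2_summable_scale)

lift_definition scaleR_ell2 :: "real \<Rightarrow> ell2 \<Rightarrow> ell2" is "\<lambda>r f k. complex_of_real r * f k"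
  by (rule ell2_summable_scale)

lift_definition norm_ell2 :: "ell2 \<Rightarrow> real" is "\<lambda>f. sqrt (\<Sum>k. (norm (f k))\<^sup>2)" .

lift_definition cinner_ell2 :: "ell2 \<Rightarrow> ell2 \<Rightarrow> complex" is "\<lambda>f g. \<Sum>k. cnj (f k) * g k" .

definition sgn_ell2 :: "ell2 \<Rightarrow> ell2" where "sgn_ell2 x = inverse (norm x) *\<^sub>R x"

definition dist_ell2 :: "ell2 \<Rightarrow> ell2 \<Rightarrow> real" where "dist_ell2 x y = norm (x - y)"

definition uniformity_ell2 :: "(ell2 \<times> ell2) filter" where
  "uniformity_ell2 = (INF e\<in>{0<..}. principal {(x, y). dist x y < e})"

definition open_ell2 :: "ell2 set \<Rightarrow> bool" where
  "open_ell2 U \<longleftrightarrow> (\<forall>x\<in>U. eventually (\<lambda>(x', y). x' = x \<longrightarrow> y \<in> U) uniformity)"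

instance
proof
  fix x y z :: ell2 and c d :: complex and r s :: real
  show "x + y + z = x + (y + z)" by transfer (simp add: add.assoc)
  show "x + y = y + x" by transfer (simp add: add.commute)
  show "0 + x = x" by transfer simp
  show "- x + x = 0" by transfer simp
  show "x - y = x + - y" by transfer simp
  show "r *\<^sub>R (x + y) = r *\<^sub>R x + r *\<^sub>R y" by transfer (simp add: algebra_simps)
  show "(r + s) *\<^sub>R x = r *\<^sub>R x + s *\<^sub>R x" by transfer (simp add: algebra_simps)
  show "r *\<^sub>R s *\<^sub>R x = (r * s) *\<^sub>R x" by transfer (simp add: algebra_simps)
  show "1 *\<^sub>R x = x" by transfer simp
  show "c *\<^sub>C (x + y) = c *\<^sub>C x + c *\<^sub>C y" by transfer (simp add: algebra_simps)
  show "(c + d) *\<^sub>C x = c *\<^sub>C x + d *\<^sub>C x" by transfer (simp add: algebra_simps)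
  show "c *\<^sub>C d *\<^sub>C x = (c * d) *\<^sub>C x" by transfer (simp add: algebra_simps)
  show "1 *\<^sub>C x = x" by transfer simp
  show "r *\<^sub>R x = complex_of_real r *\<^sub>C x" by transfer simp
  show "sgn x = inverse (norm x) *\<^sub>R x" by (rule sgn_ell2_def)
  show "dist x y = norm (x - y)" by (rule dist_ell2_def)
  show "uniformity = (INF e\<in>{0<..}. principal {(x :: ell2, y). dist x y < e})"
    by (rule uniformity_ell2_def)
  show "open U \<longleftrightarrow> (\<forall>x\<in>U. eventually (\<lambda>(x', y). x' = x \<longrightarrow> y \<in> U) uniformity)" for U :: "ell2 set"
    by (rule open_ell2_def)
  show "norm x = 0 \<longleftrightarrow> x = 0"
    by transfer (simp add: suminf_eq_zero_iff fun_eq_iff)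
  show "norm (x + y) \<le> norm x + norm y"
    by transfer (rule ell2_norm_triangle)
  show "norm (r *\<^sub>R x) = \<bar>r\<bar> * norm x"
    by transfer (simp add: norm_mult power_mult_distrib suminf_mult real_sqrt_mult)
  show "cinner x y = cnj (cinner y x)"
  proof transfer
    fix f g :: "nat \<Rightarrow> complex"
    assume "summable (\<lambda>k. (norm (f k))\<^sup>2)" "summable (\<lambda>k. (norm (g k))\<^sup>2)"
    then have "(\<lambda>k. cnj (g k) * f k) sums (\<Sum>k. cnj (g k) * f k)"
      by (intro summable_sums ell2_summable_cinner)
    then have "(\<lambda>k. cnj (cnj (g k) * f k)) sums cnj (\<Sum>k. cnj (g k) * f k)"
      by (simp only: sums_cnj)
    then show "(\<Sum>k. cnj (f k) * g k) = cnj (\<Sum>k. cnj (g k) * f k)"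
      by (simp add: sums_iff mult.commute)
  qed
  show "cinner x (y + z) = cinner x y + cinner x z"
    by transfer (simp add: distrib_left suminf_add ell2_summable_cinner)
  show "cinner x (c *\<^sub>C y) = c * cinner x y"
    by transfer (simp add: mult.left_commute[of "cnj _"] suminf_mult ell2_summable_cinner)
  show "cinner x x = complex_of_real ((norm x)\<^sup>2)"
  proof transfer
    fix f :: "nat \<Rightarrow> complex"
    assume f: "summable (\<lambda>k. (norm (f k))\<^sup>2)"
    have "cnj (f k) * f k = complex_of_real ((norm (f k))\<^sup>2)" for k
      by (simp only: complex_norm_square mult.commute)
    then show "(\<Sum>k. cnj (f k) * f k) = complex_of_real ((sqrt (\<Sum>k. (norm (f k))\<^sup>2))\<^sup>2)"
      using f by (simp add: suminf_of_real suminf_nonneg del: of_real_power)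
  qed
qed

end

lemma ell2_norm_eq: "(norm x)\<^sup>2 = (\<Sum>k. (norm (Rep_ell2 x k))\<^sup>2)"
  using Rep_ell2[of x] by (simp add: norm_ell2.rep_eq suminf_nonneg)

lemma ell2_sum_le: "(\<Sum>k<n. (norm (Rep_ell2 x k))\<^sup>2) \<le> (norm x)\<^sup>2"
  unfolding ell2_norm_eq using Rep_ell2[of x] by (intro sum_le_suminf) auto

lemma ell2_coord_le: "norm (Rep_ell2 x k) \<le> norm x"
proof -
  have "(norm (Rep_ell2 x k))\<^sup>2 \<le> (\<Sum>j<Suc k. (norm (Rep_ell2 x j))\<^sup>2)"
    by (simp add: sum_nonneg)
  also have "\<dots> \<le> (norm x)\<^sup>2"
    by (rule ell2_sum_le)
  finally show ?thesis
    by (rule power2_le_imp_le) simp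
qed

instance ell2 :: complex_hilbert
proof
  fix X :: "nat \<Rightarrow> ell2"
  assume X: "Cauchy X"
  have "Cauchy (\<lambda>n. Rep_ell2 (X n) k)" for k
  proof (rule CauchyI)
    fix e :: real
    assume "0 < e"
    then obtain M where "\<forall>m\<ge>M. \<forall>n\<ge>M. norm (X m - X n) < e"
      using CauchyD[OF X] by blast
    then have "norm (Rep_ell2 (X m) k - Rep_ell2 (X n) k) < e" if "m \<ge> M" "n \<ge> M" for m n
      using ell2_coord_le[of "X m - X n" k] that by (fastforce simp: minus_ell2.rep_eq)
    then show "\<exists>M. \<forall>m\<ge>M. \<forall>n\<ge>M. norm (Rep_ell2 (X m) k - Rep_ell2 (X n) k) < e"
      by blast
  qed
  then have "\<exists>l. (\<lambda>n. Rep_ell2 (X n) k) \<longlonglongrightarrow> l" for k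
    using Cauchy_convergent convergent_def by blast
  then obtain f where f: "\<And>k. (\<lambda>n. Rep_ell2 (X n) k) \<longlonglongrightarrow> f k"
    by metis
  have tail: "\<exists>M. \<forall>m\<ge>M. \<forall>N. (\<Sum>k<N. (norm (Rep_ell2 (X m) k - f k))\<^sup>2) \<le> e\<^sup>2" if "0 < e" for e :: real
  proof -
    obtain M where M: "\<forall>m\<ge>M. \<forall>n\<ge>M. norm (X m - X n) < e"
      using CauchyD[OF X \<open>0 < e\<close>] by blast
    have "(\<Sum>k<N. (norm (Rep_ell2 (X m) k - f k))\<^sup>2) \<le> e\<^sup>2" if "m \<ge> M" for m N
    proof (rule LIMSEQ_le_const2)
      show "(\<lambda>n. \<Sum>k<N. (norm (Rep_ell2 (X m) k - Rep_ell2 (X n) k))\<^sup>2)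
          \<longlonglongrightarrow> (\<Sum>k<N. (norm (Rep_ell2 (X m) k - f k))\<^sup>2)"
        by (intro tendsto_intros f)
      have "(\<Sum>k<N. (norm (Rep_ell2 (X m) k - Rep_ell2 (X n) k))\<^sup>2) \<le> e\<^sup>2" if "n \<ge> M" for n
      proof -
        have "(\<Sum>k<N. (norm (Rep_ell2 (X m) k - Rep_ell2 (X n) k))\<^sup>2) \<le> (norm (X m - X n))\<^sup>2"
          using ell2_sum_le[of "X m - X n" N] by (simp add: minus_ell2.rep_eq)
        also have "\<dots> \<le> e\<^sup>2"
          using M \<open>m \<ge> M\<close> that by (intro power_mono) (auto simp: less_imp_le)
        finally show ?thesis .
      qed
      then show "\<exists>K. \<forall>n\<ge>K. (\<Sum>k<N. (norm (Rep_ell2 (X m) k - Rep_ell2 (X n) k))\<^sup>2) \<le> e\<^sup>2"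
        by blast
    qed
    then show ?thesis
      by blast
  qed
  have summable_tail: "summable (\<lambda>k. (norm (Rep_ell2 (X m) k - f k))\<^sup>2)"
    if "\<forall>N. (\<Sum>k<N. (norm (Rep_ell2 (X m) k - f k))\<^sup>2) \<le> e\<^sup>2" for m and e :: real
    using that by (intro bounded_imp_summable[where B = "e\<^sup>2"])
      (auto simp: lessThan_Suc_atMost[symmetric] simp del: sum.lessThan_Suc)
  obtain m where "\<forall>N. (\<Sum>k<N. (norm (Rep_ell2 (X m) k - f k))\<^sup>2) \<le> 1\<^sup>2"
    using tail[of 1] by auto
  then have "summable (\<lambda>k. (norm (Rep_ell2 (X m) k - f k))\<^sup>2)"
    by (rule summable_tail)
  then have "summable (\<lambda>k. (norm (- (Rep_ell2 (X m) k - f k) + Rep_ell2 (X m) k))\<^sup>2)"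
    using Rep_ell2[of "X m"]
    by (intro ell2_summable_add) (simp_all only: norm_minus_cancel mem_Collect_eq)
  then have f_mem: "summable (\<lambda>k. (norm (f k))\<^sup>2)"
    by simp
  define x where "x = Abs_ell2 f"
  have Rep_x: "Rep_ell2 x = f"
    unfolding x_def using f_mem by (simp add: Abs_ell2_inverse)
  have "X \<longlonglongrightarrow> x"
  proof (rule LIMSEQ_I)
    fix e :: real
    assume "0 < e"
    then obtain M where M: "\<forall>m\<ge>M. \<forall>N. (\<Sum>k<N. (norm (Rep_ell2 (X m) k - f k))\<^sup>2) \<le> (e / 2)\<^sup>2"
      using tail[of "e / 2"] by auto
    have "norm (X m - x) < e" if "m \<ge> M" for m
    proof -
      have "(norm (X m - x))\<^sup>2 \<le> (e / 2)\<^sup>2"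
        unfolding ell2_norm_eq minus_ell2.rep_eq Rep_x
        using M that by (intro suminf_le_const summable_tail[where e = "e / 2"]) auto
      then have "norm (X m - x) \<le> e / 2"
        by (rule power2_le_imp_le) (use \<open>0 < e\<close> in simp)
      then show ?thesis
        using \<open>0 < e\<close> by simp
    qed
    then show "\<exists>M. \<forall>m\<ge>M. norm (X m - x) < e"
      by blast
  qed
  then show "convergent X"
    by (rule convergentI)
qed

section \<open>Operator algebras\<close>

text \<open>Complex scalar multiples of bounded (real-)linear maps into a complex inner product space.\<close>

instantiation blinfun :: (real_normed_vector, complex_inner) complex_vector
begin

lift_definition scaleC_blinfun :: "complex \<Rightarrow> ('a \<Rightarrow>\<^sub>L 'b) \<Rightarrow> ('a \<Rightarrow>\<^sub>L 'b)" is "\<lambda>c T x. c *\<^sub>C T x"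
  by (rule bounded_linear_compose[OF bounded_linear_scaleC])

instance
  by standard (transfer; simp add: scaleC_add_right scaleC_add_left scaleC_scaleC scaleC_one scaleR_scaleC)+

end

text \<open>\<open>'h \<Rightarrow>\<^sub>L 'h\<close> is the type of bounded real-linear maps, so complex homogeneity has
  to be imposed. The norm on this type is the operator norm.\<close>

definition bounded_operators :: "('h::complex_hilbert \<Rightarrow>\<^sub>L 'h) set" where
  "bounded_operators = {T. \<forall>c x. blinfun_apply T (c *\<^sub>C x) = c *\<^sub>C blinfun_apply T x}"

definition operator_algebra :: "('h::complex_hilbert \<Rightarrow>\<^sub>L 'h) set \<Rightarrow> bool" where
  "operator_algebra A \<longleftrightarrow>
     A \<subseteq> bounded_operators \<and> complex_vector.subspace A \<and>
     (\<forall>S\<in>A. \<forall>T\<in>A. S o\<^sub>L T \<in> A) \<and> closed A"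

text \<open>The identity of a unital operator algebra need not be the identity operator. Thus the algebras
  on \<^typ>\<open>ell2\<close> include, up to isometric isomorphism, those on every separable Hilbert space:
  embed the space in \<^typ>\<open>ell2\<close> and extend operators by zero on the orthogonal complement.\<close>

definition unital_operator_algebra :: "('h::complex_hilbert \<Rightarrow>\<^sub>L 'h) set \<Rightarrow> bool" where
  "unital_operator_algebra A \<longleftrightarrow>
     operator_algebra A \<and> (\<exists>e\<in>A. norm e = 1 \<and> (\<forall>T\<in>A. e o\<^sub>L T = T \<and> T o\<^sub>L e = T))"

definition closed_left_ideal ::
    "('h::complex_hilbert \<Rightarrow>\<^sub>L 'h) set \<Rightarrow> ('h \<Rightarrow>\<^sub>L 'h) set \<Rightarrow> bool" where
  "closed_left_ideal A J \<longleftrightarrow>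
     J \<subseteq> A \<and> complex_vector.subspace J \<and> (\<forall>T\<in>A. \<forall>S\<in>J. T o\<^sub>L S \<in> J) \<and> closed J"

text \<open>Nets are rendered by proper filters on the space of operators: a net \<open>(e\<^sub>t)\<close> gives the filter
  generated by its tails, and a filter \<open>F\<close> as below gives the net of all pairs \<open>(e, P)\<close> with
  \<open>e \<in> P \<subseteq> J \<inter> cball 0 1\<close> and \<open>P\<close> in \<open>F\<close>, directed by reverse inclusion of the sets \<open>P\<close>.\<close>

definition has_contractive_approximate_identity :: "('h::complex_hilbert \<Rightarrow>\<^sub>L 'h) set \<Rightarrow> bool" where
  "has_contractive_approximate_identity J \<longleftrightarrow>
     (\<exists>F. F \<noteq> bot \<and> (\<forall>\<^sub>F e in F. e \<in> J \<and> norm e \<le> 1) \<and>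
        (\<forall>x\<in>J. ((\<lambda>e. e o\<^sub>L x) \<longlongrightarrow> x) F \<and> ((\<lambda>e. x o\<^sub>L e) \<longlongrightarrow> x) F))"

end

theory Submission
  imports Defs
begin

text \<open>
  Write the sequence space as \<open>\<complex> e\<^sub>0 \<oplus> H\<close>, where \<open>H\<close> is spanned by \<open>e\<^sub>1, e\<^sub>2, \<dots>\<close>. The algebra consists
  of the operators \<open>(w, D)\<close> that map \<open>e\<^sub>0\<close> to an arbitrary vector \<open>w\<close> and act on \<open>H\<close> as a bounded
  diagonal operator \<open>D\<close>. The left ideal is a copy of \<open>c\<^sub>0\<close>: it consists of the \<open>(0, D)\<close> for which the
  diagonal entries of \<open>D\<close> tend to zero. It is not a right ideal: \<open>(0, D)(w, I)\<close> maps \<open>e\<^sub>0\<close> to \<open>D w\<close> if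
  \<open>w \<in> H\<close>. The projections onto \<open>e\<^sub>1, \<dots>, e\<^sub>n\<close> are a contractive
  approximate identity of the ideal.

  The element to be approximated is \<open>b = (v, I)\<close>, where \<open>v \<in> H\<close> is a unit vector all of whose
  coordinates in \<open>H\<close> are nonzero. Subtracting the projection onto
  \<open>e\<^sub>1, \<dots>, e\<^sub>n\<close> leaves the identity on the coordinates beyond \<open>n\<close>, whose range is orthogonal to the
  column \<open>v\<close> up to a small tail of \<open>v\<close>; hence the distance of \<open>b\<close> from the ideal is at most \<open>1\<close>
  (\<open>distance_bordered_identity_le\<close>). If \<open>b - y\<close> were a contraction for some \<open>y\<close> in the ideal, then,
  as its column \<open>v\<close> already has norm \<open>1\<close>, the other columns would have to be orthogonal to \<open>v\<close>.
  But those are multiples \<open>t\<^sub>k e\<^sub>k\<close> of the basis vectors, so \<open>t\<^sub>k\<close> would vanish for every \<open>k \<ge> 1\<close>,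
  whereas \<open>t\<^sub>k = 1 - y\<^sub>k\<^sub>k\<close> tends to \<open>1\<close> (\<open>norm_bordered_identity_diff_gt\<close>).
\<close>

section \<open>Coordinates and coordinate projections in the sequence space\<close>

lemma ell2_eqI: "(\<And>k. Rep_ell2 x k = Rep_ell2 y k) \<Longrightarrow> x = y"
  by (metis Rep_ell2_inject ext)

lemma ell2_summable: "summable (\<lambda>k. (norm (Rep_ell2 x k))\<^sup>2)"
  using Rep_ell2[of x] by simp

lemma ell2_norm_le:
  assumes "0 \<le> c" and "\<And>k. norm (Rep_ell2 y k) \<le> c * norm (Rep_ell2 x k)"
  shows "norm y \<le> c * norm x"
proof -
  have "(norm y)\<^sup>2 \<le> (\<Sum>k. c\<^sup>2 * (norm (Rep_ell2 x k))\<^sup>2)"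
    unfolding ell2_norm_eq
    using power_mono[OF assms(2), of _ 2]
    by (intro suminf_le ell2_summable summable_mult) (auto simp: power_mult_distrib)
  also have "\<dots> = (c * norm x)\<^sup>2"
    by (simp add: suminf_mult ell2_summable ell2_norm_eq power_mult_distrib)
  finally show ?thesis
    by (rule power2_le_imp_le) (use assms(1) in simp)
qed

lemma bounded_linear_coordinate: "bounded_linear (\<lambda>x. Rep_ell2 x k)"
  by (rule bounded_linear_intro[of _ 1])
    (simp_all add: plus_ell2.rep_eq scaleR_ell2.rep_eq scaleR_conv_of_real ell2_coord_le)

lemma norm_add_sq: "(norm (x + y))\<^sup>2 = (norm x)\<^sup>2 + (norm y)\<^sup>2 + 2 * Re (cinner x y)"
  for x y :: "'a::complex_inner"
proof -
  have left: "cinner (x + y) z = cinner x z + cinner y z" for z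
    by (subst (1 2 3) cinner_commute) (simp add: cinner_add_right)
  have "complex_of_real ((norm (x + y))\<^sup>2)
      = cinner x x + cinner y y + (cinner x y + cnj (cinner x y))"
    by (simp add: cinner_self[symmetric] left cinner_add_right cinner_commute[of y x]
        del: of_real_power)
  then have "Re (complex_of_real ((norm (x + y))\<^sup>2))
      = Re (cinner x x + cinner y y + (cinner x y + cnj (cinner x y)))"
    by simp
  then show ?thesis
    by (simp add: cinner_self del: of_real_power)
qed

lift_definition basis :: "nat \<Rightarrow> ell2" is "\<lambda>k j. if j = k then 1 else 0"
proof -
  fix k :: nat
  have "summable (\<lambda>j. if j = k then 1 else 0 :: real)"
    by simp
  then show "summable (\<lambda>j. (norm (if j = k then 1 else 0 :: complex))\<^sup>2)"
    by (rule back_subst[of summable]) auto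
qed

lemma cinner_basis: "cinner x (basis k) = cnj (Rep_ell2 x k)"
proof -
  have "(\<lambda>j. cnj (Rep_ell2 x j) * Rep_ell2 (basis k) j) = (\<lambda>j. if j = k then cnj (Rep_ell2 x j) else 0)"
    by (auto simp: basis.rep_eq)
  then show ?thesis
    unfolding cinner_ell2.rep_eq using sums_single[of k "\<lambda>j. cnj (Rep_ell2 x j)"] by (simp add: sums_iff)
qed

lemma norm_basis: "norm (basis k) = 1"
proof -
  have "complex_of_real ((norm (basis k))\<^sup>2) = 1"
    unfolding cinner_self[symmetric] cinner_basis by (simp add: basis.rep_eq)
  then have "(norm (basis k))\<^sup>2 = 1"
    unfolding of_real_eq_1_iff .
  then show ?thesis
    unfolding power2_eq_1_iff using norm_ge_zero[of "basis k"] by linarith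
qed

lemma eq_scaleC_basis:
  "(\<And>j. j \<noteq> k \<Longrightarrow> Rep_ell2 x j = 0) \<Longrightarrow> x = Rep_ell2 x k *\<^sub>C basis k"
  by (rule ell2_eqI) (auto simp: scaleC_ell2.rep_eq basis.rep_eq)

lift_definition coord_proj :: "nat set \<Rightarrow> ell2 \<Rightarrow> ell2" is "\<lambda>M f k. if k \<in> M then f k else 0"
  by (erule summable_comparison_test'[where N = 0]) auto

lemma norm_coord_proj_le: "norm (coord_proj M x) \<le> norm x"
  using ell2_norm_le[of 1 "coord_proj M x" x] by (simp add: coord_proj.rep_eq)

lemma norm_sq_coord_proj_disjoint:
  assumes "M \<inter> N = {}"
  shows "(norm (coord_proj M x + coord_proj N y))\<^sup>2 = (norm (coord_proj M x))\<^sup>2 + (norm (coord_proj N y))\<^sup>2"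
proof -
  have "(\<lambda>k. cnj (Rep_ell2 (coord_proj M x) k) * Rep_ell2 (coord_proj N y) k) = (\<lambda>_. 0)"
    using assms by (auto simp: coord_proj.rep_eq fun_eq_iff)
  then have "cinner (coord_proj M x) (coord_proj N y) = 0"
    unfolding cinner_ell2.rep_eq by simp
  then show ?thesis
    by (simp add: norm_add_sq)
qed

lemma coord_proj_tail_tendsto: "(\<lambda>n. coord_proj {n..} x) \<longlonglongrightarrow> 0"
proof -
  have "(norm (coord_proj {n..} x))\<^sup>2 = (norm x)\<^sup>2 - (\<Sum>k<n. (norm (Rep_ell2 x k))\<^sup>2)" for n
  proof -
    have split: "coord_proj {..<n} x + coord_proj {n..} x = x"
      by (rule ell2_eqI) (auto simp: plus_ell2.rep_eq coord_proj.rep_eq)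
    have "{..<n} \<inter> {n..} = {}"
      by auto
    then have "(norm x)\<^sup>2 = (norm (coord_proj {..<n} x))\<^sup>2 + (norm (coord_proj {n..} x))\<^sup>2"
      using norm_sq_coord_proj_disjoint[of "{..<n}" "{n..}" x x] unfolding split by simp
    moreover have "(norm (coord_proj {..<n} x))\<^sup>2 = (\<Sum>k<n. (norm (Rep_ell2 x k))\<^sup>2)"
      unfolding ell2_norm_eq coord_proj.rep_eq
      by (subst suminf_finite[of "{..<n}"]) auto
    ultimately show ?thesis
      by simp
  qed
  moreover have "(\<lambda>n. (norm x)\<^sup>2 - (\<Sum>k<n. (norm (Rep_ell2 x k))\<^sup>2)) \<longlonglongrightarrow> (norm x)\<^sup>2 - (norm x)\<^sup>2"
    unfolding ell2_norm_eq by (intro tendsto_intros summable_LIMSEQ ell2_summable)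
  ultimately have "(\<lambda>n. (norm (coord_proj {n..} x))\<^sup>2) \<longlonglongrightarrow> 0"
    by simp
  then have "(\<lambda>n. sqrt ((norm (coord_proj {n..} x))\<^sup>2)) \<longlonglongrightarrow> sqrt 0"
    by (rule tendsto_real_sqrt)
  then show ?thesis
    by (simp add: tendsto_norm_zero_iff)
qed

lemma coord_proj_initial_tendsto: "(\<lambda>n. coord_proj {..<n} x) \<longlonglongrightarrow> x"
proof -
  have "coord_proj {..<n} x = x - coord_proj {n..} x" for n
    by (rule ell2_eqI) (auto simp: minus_ell2.rep_eq coord_proj.rep_eq)
  then show ?thesis
    using tendsto_diff[OF tendsto_const coord_proj_tail_tendsto, of x x] by simp
qed

section \<open>Operators that are diagonal in the standard basis\<close>

lemma operator_scaleC: "T \<in> bounded_operators \<Longrightarrow> blinfun_apply T (c *\<^sub>C x) = c *\<^sub>C blinfun_apply T x"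
  by (simp add: bounded_operators_def)

text \<open>Continuity extends the action of the operator from finitely supported vectors to all vectors.\<close>

lemma diagonal_operator_coordinates:
  assumes T: "T \<in> bounded_operators"
    and diag: "\<And>k. blinfun_apply T (basis k) = s k *\<^sub>C basis k"
  shows "Rep_ell2 (blinfun_apply T x) k = s k * Rep_ell2 x k"
proof -
  have initial: "Rep_ell2 (blinfun_apply T (coord_proj {..<n} x)) k = (if k < n then s k * Rep_ell2 x k else 0)" for n
  proof (induction n)
    case 0
    have "coord_proj {..<0} x = 0"
      by (rule ell2_eqI) (simp add: coord_proj.rep_eq zero_ell2.rep_eq)
    then show ?case
      by (simp add: blinfun.zero_right zero_ell2.rep_eq)
  next
    case (Suc n)
    have "coord_proj {..<Suc n} x = coord_proj {..<n} x + Rep_ell2 x n *\<^sub>C basis n"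
      by (rule ell2_eqI) (auto simp: coord_proj.rep_eq plus_ell2.rep_eq scaleC_ell2.rep_eq basis.rep_eq less_Suc_eq)
    then show ?case
      using Suc by (auto simp: blinfun.add_right operator_scaleC[OF T] diag plus_ell2.rep_eq
          scaleC_ell2.rep_eq basis.rep_eq less_Suc_eq)
  qed
  have "(\<lambda>n. Rep_ell2 (blinfun_apply T (coord_proj {..<n} x)) k) \<longlonglongrightarrow> Rep_ell2 (blinfun_apply T x) k"
    by (intro bounded_linear.tendsto[OF bounded_linear_coordinate]
        bounded_linear.tendsto[OF blinfun.bounded_linear_right] coord_proj_initial_tendsto)
  moreover have "\<forall>\<^sub>F n in sequentially. Rep_ell2 (blinfun_apply T (coord_proj {..<n} x)) k = s k * Rep_ell2 x k"
    using eventually_gt_at_top[of k] by eventually_elim (simp add: initial)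
  then have "(\<lambda>n. Rep_ell2 (blinfun_apply T (coord_proj {..<n} x)) k) \<longlonglongrightarrow> s k * Rep_ell2 x k"
    by (rule tendsto_eventually)
  ultimately show ?thesis
    by (rule LIMSEQ_unique)
qed

lift_definition coord_proj_op :: "nat set \<Rightarrow> (ell2 \<Rightarrow>\<^sub>L ell2)" is coord_proj
proof (rule bounded_linear_intro[of _ 1])
  fix M x y and r :: real
  show "coord_proj M (x + y) = coord_proj M x + coord_proj M y"
    by (rule ell2_eqI) (simp add: coord_proj.rep_eq plus_ell2.rep_eq)
  show "coord_proj M (r *\<^sub>R x) = r *\<^sub>R coord_proj M x"
    by (rule ell2_eqI) (simp add: coord_proj.rep_eq scaleR_ell2.rep_eq)
  show "norm (coord_proj M x) \<le> norm x * 1"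
    by (simp add: norm_coord_proj_le)
qed

lemma coord_proj_op_bounded_operator: "coord_proj_op M \<in> bounded_operators"
  unfolding bounded_operators_def
  by (auto simp: coord_proj_op.rep_eq coord_proj.rep_eq scaleC_ell2.rep_eq intro!: ell2_eqI)

lemma coord_proj_op_basis: "blinfun_apply (coord_proj_op M) (basis k) = (if k \<in> M then basis k else 0)"
  by (rule ell2_eqI) (auto simp: coord_proj_op.rep_eq coord_proj.rep_eq basis.rep_eq zero_ell2.rep_eq)

lemma norm_coord_proj_op_le: "norm (coord_proj_op M) \<le> 1"
  by (rule norm_blinfun_bound) (simp_all add: coord_proj_op.rep_eq norm_coord_proj_le)

section \<open>The operator algebra and its left ideal\<close>

text \<open>Vanishing matrix entries are closed conditions, so in this form closedness of the algebra is
  immediate. They say that every \<open>e\<^sub>k\<close> with \<open>k \<ge> 1\<close> is an eigenvector, a property that products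
  inherit.\<close>

definition border_algebra :: "(ell2 \<Rightarrow>\<^sub>L ell2) set" where
  "border_algebra = {T \<in> bounded_operators.
     \<forall>k j. k \<noteq> 0 \<longrightarrow> j \<noteq> k \<longrightarrow> Rep_ell2 (blinfun_apply T (basis k)) j = 0}"

text \<open>The operator sends \<open>e\<^sub>k\<close> to its \<open>k\<close>-th diagonal entry times \<open>e\<^sub>k\<close>, so the limit condition says
  that the diagonal entries tend to zero. Stated with vectors it is preserved by every bounded operator
  from the left.\<close>

definition null_diagonal_ideal :: "(ell2 \<Rightarrow>\<^sub>L ell2) set" where
  "null_diagonal_ideal = {T \<in> border_algebra.
     blinfun_apply T (basis 0) = 0 \<and> (\<lambda>k. blinfun_apply T (basis k)) \<longlonglongrightarrow> 0}"

definition diagonal_entry :: "(ell2 \<Rightarrow>\<^sub>L ell2) \<Rightarrow> nat \<Rightarrow> complex" where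
  "diagonal_entry T k = Rep_ell2 (blinfun_apply T (basis k)) k"

lemma border_algebra_basis:
  "T \<in> border_algebra \<Longrightarrow> k \<noteq> 0 \<Longrightarrow> blinfun_apply T (basis k) = diagonal_entry T k *\<^sub>C basis k"
  unfolding diagonal_entry_def by (intro eq_scaleC_basis) (simp add: border_algebra_def)

lemma norm_diagonal_entry_le: "norm (diagonal_entry T k) \<le> norm (blinfun_apply T (basis k))"
  by (simp add: diagonal_entry_def ell2_coord_le)

lemma border_algebra_bounded_operator: "T \<in> border_algebra \<Longrightarrow> T \<in> bounded_operators"
  by (simp add: border_algebra_def)

lemma null_diagonal_ideal_subset: "null_diagonal_ideal \<subseteq> border_algebra"
  by (auto simp: null_diagonal_ideal_def)

lemma null_diagonal_ideal_diagonal_entry_0: "S \<in> null_diagonal_ideal \<Longrightarrow> diagonal_entry S 0 = 0"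
  by (simp add: null_diagonal_ideal_def diagonal_entry_def zero_ell2.rep_eq)

lemma null_diagonal_ideal_coordinates:
  assumes "S \<in> null_diagonal_ideal"
  shows "Rep_ell2 (blinfun_apply S x) k = diagonal_entry S k * Rep_ell2 x k"
proof (rule diagonal_operator_coordinates)
  show "S \<in> bounded_operators"
    using assms by (simp add: null_diagonal_ideal_def border_algebra_def)
  show "blinfun_apply S (basis j) = diagonal_entry S j *\<^sub>C basis j" for j
    using assms border_algebra_basis[of S j]
    by (cases "j = 0") (auto simp: null_diagonal_ideal_def diagonal_entry_def zero_ell2.rep_eq)
qed

lemma scaleC_blinfun_apply: "blinfun_apply (c *\<^sub>C T) x = c *\<^sub>C blinfun_apply T x"
  by (simp add: scaleC_blinfun.rep_eq)

lemma closed_bounded_operators: "closed (bounded_operators :: (ell2 \<Rightarrow>\<^sub>L ell2) set)"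
  unfolding bounded_operators_def
  by (intro closed_Collect_all closed_Collect_eq continuous_intros
      bounded_linear.continuous_on[OF bounded_linear_scaleC])

lemma operator_algebra_border_algebra: "operator_algebra border_algebra"
  unfolding operator_algebra_def
proof (intro conjI ballI)
  show "border_algebra \<subseteq> bounded_operators"
    by (auto simp: border_algebra_def)
  show "complex_vector.subspace border_algebra"
    by (auto simp: complex_vector.subspace_def border_algebra_def bounded_operators_def
        blinfun.add_left scaleC_blinfun_apply scaleC_add_right scaleC_scaleC mult.commute
        plus_ell2.rep_eq zero_ell2.rep_eq scaleC_ell2.rep_eq intro: ell2_eqI)
  show "closed border_algebra"
  proof -
    have "closed {T. k \<noteq> 0 \<longrightarrow> j \<noteq> k \<longrightarrow> Rep_ell2 (blinfun_apply T (basis k)) j = 0}" for k j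
      by (cases "k = 0 \<or> j = k")
        (auto intro!: closed_Collect_eq continuous_intros bounded_linear.continuous_on[OF bounded_linear_coordinate])
    then show ?thesis
      unfolding border_algebra_def Collect_conj_eq Collect_mem_eq
      by (intro closed_Int closed_bounded_operators closed_Collect_all)
  qed
  fix S T assume S: "S \<in> border_algebra" and T: "T \<in> border_algebra"
  have "Rep_ell2 (blinfun_apply S (blinfun_apply T (basis k))) j = 0" if "k \<noteq> 0" "j \<noteq> k" for k j
    using S that
    by (subst border_algebra_basis[OF T \<open>k \<noteq> 0\<close>])
      (simp add: operator_scaleC border_algebra_def scaleC_ell2.rep_eq)
  then show "S o\<^sub>L T \<in> border_algebra"
    using S T by (simp add: border_algebra_def bounded_operators_def)
qed

lemma unital_operator_algebra_border_algebra: "unital_operator_algebra border_algebra"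
  unfolding unital_operator_algebra_def
proof (intro conjI operator_algebra_border_algebra bexI ballI)
  show "id_blinfun \<in> border_algebra"
    by (simp add: border_algebra_def bounded_operators_def basis.rep_eq)
  show "norm (id_blinfun :: ell2 \<Rightarrow>\<^sub>L ell2) = 1"
  proof (rule antisym)
    show "norm (id_blinfun :: ell2 \<Rightarrow>\<^sub>L ell2) \<le> 1"
      by (rule norm_blinfun_bound) simp_all
    show "1 \<le> norm (id_blinfun :: ell2 \<Rightarrow>\<^sub>L ell2)"
      using norm_blinfun[of "id_blinfun" "basis 0"] by (simp add: norm_basis)
  qed
qed (auto intro!: blinfun_eqI)

lemma closed_left_ideal_null_diagonal_ideal: "closed_left_ideal border_algebra null_diagonal_ideal"
  unfolding closed_left_ideal_def
proof (intro conjI ballI null_diagonal_ideal_subset)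
  have A: "complex_vector.subspace border_algebra" "closed border_algebra"
    "\<And>S T. S \<in> border_algebra \<Longrightarrow> T \<in> border_algebra \<Longrightarrow> S o\<^sub>L T \<in> border_algebra"
    using operator_algebra_border_algebra by (auto simp: operator_algebra_def)
  show "complex_vector.subspace null_diagonal_ideal"
  proof (rule complex_vector.subspaceI)
    show "0 \<in> null_diagonal_ideal"
      using complex_vector.subspace_0[OF A(1)] by (simp add: null_diagonal_ideal_def)
    show "S + T \<in> null_diagonal_ideal" if "S \<in> null_diagonal_ideal" "T \<in> null_diagonal_ideal" for S T
      using that complex_vector.subspace_add[OF A(1)]
        tendsto_add[of "\<lambda>k. blinfun_apply S (basis k)" 0 _ "\<lambda>k. blinfun_apply T (basis k)" 0]
      by (simp add: null_diagonal_ideal_def blinfun.add_left)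
    show "c *\<^sub>C T \<in> null_diagonal_ideal" if "T \<in> null_diagonal_ideal" for c T
      using that complex_vector.subspace_scale[OF A(1)]
        bounded_linear.tendsto[OF bounded_linear_scaleC[of c], of "\<lambda>k. blinfun_apply T (basis k)" 0]
      by (simp add: null_diagonal_ideal_def scaleC_blinfun_apply)
  qed
  show "T o\<^sub>L S \<in> null_diagonal_ideal" if "T \<in> border_algebra" "S \<in> null_diagonal_ideal" for T S
    using that A(3)[of T S]
      bounded_linear.tendsto[OF blinfun.bounded_linear_right[of T], of "\<lambda>k. blinfun_apply S (basis k)" 0]
    by (simp add: null_diagonal_ideal_def blinfun.zero_right)
  show "closed null_diagonal_ideal"
    unfolding closed_sequential_limits
  proof (intro allI impI, elim conjE)
    fix X T assume X: "\<forall>n. X n \<in> null_diagonal_ideal" and lim: "X \<longlonglongrightarrow> T"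
    have "T \<in> border_algebra"
      using A(2) X lim null_diagonal_ideal_subset unfolding closed_sequential_limits by blast
    moreover have "(\<lambda>n. blinfun_apply (X n) (basis 0)) \<longlonglongrightarrow> blinfun_apply T (basis 0)"
      by (intro tendsto_intros lim)
    then have "blinfun_apply T (basis 0) = 0"
      using X by (simp add: null_diagonal_ideal_def LIMSEQ_const_iff)
    moreover have "(\<lambda>k. blinfun_apply T (basis k)) \<longlonglongrightarrow> 0"
    proof (rule LIMSEQ_I)
      fix r :: real assume "0 < r"
      then obtain n where n: "norm (X n - T) < r / 2"
        using LIMSEQ_D[OF lim, of "r / 2"] by auto
      have "(\<lambda>k. blinfun_apply (X n) (basis k)) \<longlonglongrightarrow> 0"
        using X by (simp add: null_diagonal_ideal_def)
      then obtain K where K: "\<And>k. k \<ge> K \<Longrightarrow> norm (blinfun_apply (X n) (basis k)) < r / 2"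
        using LIMSEQ_D[of _ 0 "r / 2"] \<open>0 < r\<close> by fastforce
      have "norm (blinfun_apply T (basis k)) < r" if "k \<ge> K" for k
      proof -
        have "norm (blinfun_apply (X n - T) (basis k)) \<le> norm (X n - T)"
          using norm_blinfun[of "X n - T" "basis k"] by (simp add: norm_basis)
        moreover have "blinfun_apply T (basis k) = blinfun_apply (X n) (basis k) - blinfun_apply (X n - T) (basis k)"
          by (simp add: blinfun.diff_left)
        ultimately show ?thesis
          using norm_triangle_ineq4[of "blinfun_apply (X n) (basis k)" "blinfun_apply (X n - T) (basis k)"] n K[OF that]
          by simp
      qed
      then show "\<exists>K. \<forall>k\<ge>K. norm (blinfun_apply T (basis k) - 0) < r"
        by auto
    qed
    ultimately show "T \<in> null_diagonal_ideal"
      by (simp add: null_diagonal_ideal_def)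
  qed
qed

lemma coord_proj_op_null_diagonal_ideal: "coord_proj_op {1..n} \<in> null_diagonal_ideal"
proof -
  have "(\<lambda>k. blinfun_apply (coord_proj_op {1..n}) (basis k)) \<longlonglongrightarrow> 0"
    by (rule tendsto_eventually, rule eventually_mono[OF eventually_gt_at_top[of n]])
      (simp add: coord_proj_op_basis)
  then show ?thesis
    by (auto simp: null_diagonal_ideal_def border_algebra_def coord_proj_op_bounded_operator
        coord_proj_op_basis basis.rep_eq zero_ell2.rep_eq)
qed

text \<open>On the diagonal operator \<open>S\<close> the projection deletes the entries beyond \<open>n\<close>, and what is lost has
  the supremum of these entries as norm. The order of the factors is irrelevant, because diagonal
  operators commute.\<close>

lemma coord_proj_op_approximate_identity:
  assumes S: "S \<in> null_diagonal_ideal"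
  shows "(\<lambda>n. coord_proj_op {1..n} o\<^sub>L S) \<longlonglongrightarrow> S" and "(\<lambda>n. S o\<^sub>L coord_proj_op {1..n}) \<longlonglongrightarrow> S"
proof -
  have commute: "S o\<^sub>L coord_proj_op {1..n} = coord_proj_op {1..n} o\<^sub>L S" for n
    by (intro blinfun_eqI ell2_eqI)
      (simp add: null_diagonal_ideal_coordinates[OF S] coord_proj_op.rep_eq coord_proj.rep_eq)
  show left: "(\<lambda>n. coord_proj_op {1..n} o\<^sub>L S) \<longlonglongrightarrow> S"
  proof (rule LIMSEQ_I)
    fix r :: real assume "0 < r"
    have "(\<lambda>k. blinfun_apply S (basis k)) \<longlonglongrightarrow> 0"
      using S by (simp add: null_diagonal_ideal_def)
    then obtain K where K: "\<And>k. k \<ge> K \<Longrightarrow> norm (blinfun_apply S (basis k)) < r / 2"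
      using LIMSEQ_D[of _ 0 "r / 2"] \<open>0 < r\<close> by fastforce
    have "norm ((coord_proj_op {1..n} o\<^sub>L S) - S) < r" if "n \<ge> K" for n
    proof -
      have "norm ((coord_proj_op {1..n} o\<^sub>L S) - S) \<le> r / 2"
      proof (rule norm_blinfun_bound)
        fix x
        show "norm (blinfun_apply ((coord_proj_op {1..n} o\<^sub>L S) - S) x) \<le> r / 2 * norm x"
        proof (rule ell2_norm_le)
          fix k
          consider "k = 0" | "k \<in> {1..n}" | "k > n"
            by fastforce
          then show "norm (Rep_ell2 (blinfun_apply ((coord_proj_op {1..n} o\<^sub>L S) - S) x) k) \<le> r / 2 * norm (Rep_ell2 x k)"
          proof cases
            case 3
            have "norm (diagonal_entry S k) \<le> r / 2"
              using norm_diagonal_entry_le[of S k] K[of k] 3 that by simp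
            then have "norm (diagonal_entry S k) * norm (Rep_ell2 x k) \<le> r / 2 * norm (Rep_ell2 x k)"
              by (rule mult_right_mono) simp
            then show ?thesis
              using 3 \<open>0 < r\<close> by (simp add: blinfun.diff_left minus_ell2.rep_eq coord_proj_op.rep_eq
                  coord_proj.rep_eq null_diagonal_ideal_coordinates[OF S] norm_mult)
          qed (use \<open>0 < r\<close> null_diagonal_ideal_diagonal_entry_0[OF S] in \<open>simp_all add: blinfun.diff_left minus_ell2.rep_eq coord_proj_op.rep_eq
                  coord_proj.rep_eq null_diagonal_ideal_coordinates[OF S]\<close>)
        qed (use \<open>0 < r\<close> in simp)
      qed (use \<open>0 < r\<close> in simp)
      then show ?thesis
        using \<open>0 < r\<close> by simp
    qed
    then show "\<exists>K. \<forall>n\<ge>K. norm ((coord_proj_op {1..n} o\<^sub>L S) - S) < r"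
      by blast
  qed
  then show "(\<lambda>n. S o\<^sub>L coord_proj_op {1..n}) \<longlonglongrightarrow> S"
    by (simp only: commute)
qed

lemma null_diagonal_ideal_cai: "has_contractive_approximate_identity null_diagonal_ideal"
  unfolding has_contractive_approximate_identity_def
proof (intro exI conjI ballI)
  let ?F = "filtermap (\<lambda>n. coord_proj_op {1..n}) sequentially"
  show "?F \<noteq> bot"
    by (simp add: filtermap_bot_iff)
  show "\<forall>\<^sub>F e in ?F. e \<in> null_diagonal_ideal \<and> norm e \<le> 1"
    by (simp add: eventually_filtermap coord_proj_op_null_diagonal_ideal[simplified] norm_coord_proj_op_le)
  show "((\<lambda>e. e o\<^sub>L S) \<longlongrightarrow> S) ?F" "((\<lambda>e. S o\<^sub>L e) \<longlongrightarrow> S) ?F"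
    if "S \<in> null_diagonal_ideal" for S
    using coord_proj_op_approximate_identity[OF that] by (simp_all add: filterlim_filtermap)
qed

section \<open>An element without a best approximation\<close>

definition first_column_op :: "ell2 \<Rightarrow> (ell2 \<Rightarrow>\<^sub>L ell2)" where
  "first_column_op v = Blinfun (\<lambda>x. Rep_ell2 x 0 *\<^sub>C v)"

lemma first_column_op_apply: "blinfun_apply (first_column_op v) x = Rep_ell2 x 0 *\<^sub>C v"
proof -
  have "bounded_linear (\<lambda>x. Rep_ell2 x 0 *\<^sub>C v)"
    by (rule bounded_linear_intro[of _ "norm v"])
      (simp_all add: plus_ell2.rep_eq scaleC_add_left scaleC_ell2.rep_eq scaleR_scaleC scaleC_scaleC
        norm_scaleC ell2_coord_le mult_right_mono)
  then show ?thesis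
    by (simp add: first_column_op_def bounded_linear_Blinfun_apply)
qed

definition bordered_identity :: "ell2 \<Rightarrow> (ell2 \<Rightarrow>\<^sub>L ell2)" where
  "bordered_identity v = coord_proj_op {1..} + first_column_op v"

lemma bordered_identity_basis:
  "blinfun_apply (bordered_identity v) (basis k) = (if k = 0 then v else basis k)"
  by (auto simp: bordered_identity_def blinfun.add_left coord_proj_op_basis first_column_op_apply
      basis.rep_eq scaleC_one)

lemma bordered_identity_border_algebra: "bordered_identity v \<in> border_algebra"
  by (simp add: border_algebra_def bordered_identity_basis basis.rep_eq)
    (use coord_proj_op_bounded_operator[of "{1..}"] in \<open>simp add: bordered_identity_def bounded_operators_def
      blinfun.add_left first_column_op_apply scaleC_ell2.rep_eq scaleC_add_right scaleC_scaleC\<close>)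

text \<open>The difference maps \<open>x\<close> to \<open>x\<^sub>0 v\<close> plus the part of \<open>x\<close> beyond coordinate \<open>n\<close>. Only the tail of \<open>v\<close>
  interferes with that part. Without the tail the two summands are orthogonal and Pythagoras
  gives a contraction.\<close>

lemma norm_bordered_identity_diff_coord_proj_op_le:
  assumes "norm v \<le> 1" and v0: "Rep_ell2 v 0 = 0"
  shows "norm (bordered_identity v - coord_proj_op {1..n}) \<le> 1 + norm (coord_proj {Suc n..} v)"
proof (rule norm_blinfun_bound)
  fix x
  define c where "c = Rep_ell2 x 0"
  have split: "blinfun_apply (bordered_identity v - coord_proj_op {1..n}) x
      = (coord_proj {1..n} (c *\<^sub>C v) + coord_proj {Suc n..} x) + c *\<^sub>C coord_proj {Suc n..} v"
    using v0 by (intro ell2_eqI)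
      (auto simp: bordered_identity_def blinfun.add_left blinfun.diff_left coord_proj_op.rep_eq
        first_column_op_apply plus_ell2.rep_eq minus_ell2.rep_eq scaleC_ell2.rep_eq coord_proj.rep_eq
        c_def not_less_eq_eq Suc_le_eq)
  have "(norm (coord_proj {1..n} (c *\<^sub>C v) + coord_proj {Suc n..} x))\<^sup>2
      = (norm (coord_proj {1..n} (c *\<^sub>C v)))\<^sup>2 + (norm (coord_proj {Suc n..} x))\<^sup>2"
    by (rule norm_sq_coord_proj_disjoint) auto
  also have "\<dots> \<le> (norm (coord_proj {0} x))\<^sup>2 + (norm (coord_proj {Suc n..} x))\<^sup>2"
  proof -
    have "norm (coord_proj {1..n} (c *\<^sub>C v)) \<le> norm c"
      using norm_coord_proj_le[of "{1..n}" "c *\<^sub>C v"] mult_left_mono[OF assms(1), of "norm c"]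
      by (simp add: norm_scaleC)
    also have "norm c \<le> norm (coord_proj {0} x)"
      using ell2_coord_le[of "coord_proj {0} x" 0] by (simp add: coord_proj.rep_eq c_def)
    finally show ?thesis
      by (simp add: power_mono)
  qed
  also have "\<dots> = (norm (coord_proj {0} x + coord_proj {Suc n..} x))\<^sup>2"
    by (rule norm_sq_coord_proj_disjoint[symmetric]) auto
  also have "coord_proj {0} x + coord_proj {Suc n..} x = coord_proj ({0} \<union> {Suc n..}) x"
    by (rule ell2_eqI) (auto simp: coord_proj.rep_eq plus_ell2.rep_eq)
  also have "(norm \<dots>)\<^sup>2 \<le> (norm x)\<^sup>2"
    by (intro power_mono norm_coord_proj_le norm_ge_zero)
  finally have main: "norm (coord_proj {1..n} (c *\<^sub>C v) + coord_proj {Suc n..} x) \<le> norm x"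
    by (rule power2_le_imp_le) simp
  have tail: "norm (c *\<^sub>C coord_proj {Suc n..} v) \<le> norm (coord_proj {Suc n..} v) * norm x"
    unfolding norm_scaleC c_def mult.commute[of "norm (Rep_ell2 x 0)"]
    by (intro mult_left_mono ell2_coord_le norm_ge_zero)
  show "norm (blinfun_apply (bordered_identity v - coord_proj_op {1..n}) x)
      \<le> (1 + norm (coord_proj {Suc n..} v)) * norm x"
    unfolding split distrib_right mult_1_left by (rule norm_triangle_mono[OF main tail])
qed simp

lemma distance_bordered_identity_le:
  assumes "norm v \<le> 1" and "Rep_ell2 v 0 = 0"
  shows "(INF z\<in>null_diagonal_ideal. norm (bordered_identity v - z)) \<le> 1"
proof (rule LIMSEQ_le_const)
  have "(\<lambda>n. 1 + norm (coord_proj {Suc n..} v)) \<longlonglongrightarrow> 1 + norm (0 :: ell2)"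
    by (intro tendsto_intros LIMSEQ_Suc coord_proj_tail_tendsto)
  then show "(\<lambda>n. 1 + norm (coord_proj {Suc n..} v)) \<longlonglongrightarrow> 1"
    by simp
  have "(INF z\<in>null_diagonal_ideal. norm (bordered_identity v - z)) \<le> 1 + norm (coord_proj {Suc n..} v)" for n
    using coord_proj_op_null_diagonal_ideal norm_bordered_identity_diff_coord_proj_op_le[OF assms]
    by (intro cINF_lower2[where x = "coord_proj_op {1..n}"] bdd_belowI[of _ 0]) auto
  then show "\<exists>N. \<forall>n\<ge>N. (INF z\<in>null_diagonal_ideal. norm (bordered_identity v - z)) \<le> 1 + norm (coord_proj {Suc n..} v)"
    by blast
qed

text \<open>A contraction with first column \<open>v\<close> of norm \<open>1\<close> must have all other columns orthogonal to \<open>v\<close>;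
  otherwise a vector \<open>e\<^sub>0 + c e\<^sub>k\<close> is stretched. Here the column at \<open>k\<close> is \<open>t e\<^sub>k\<close> with \<open>t\<close> nonzero
  for large \<open>k\<close>, and its inner product with \<open>v\<close> does not vanish.\<close>

lemma norm_bordered_identity_diff_gt:
  assumes "norm v = 1" and v: "\<And>k. k \<noteq> 0 \<Longrightarrow> Rep_ell2 v k \<noteq> 0"
    and y: "y \<in> null_diagonal_ideal"
  shows "1 < norm (bordered_identity v - y)"
proof (rule ccontr)
  assume "\<not> ?thesis"
  then have contraction: "norm (bordered_identity v - y) \<le> 1"
    by simp
  have "(\<lambda>k. blinfun_apply y (basis k)) \<longlonglongrightarrow> 0"
    using y by (simp add: null_diagonal_ideal_def)
  then obtain K where K: "\<And>k. k \<ge> K \<Longrightarrow> norm (blinfun_apply y (basis k)) < 1"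
    using LIMSEQ_D[of _ 0 1] by fastforce
  define k where "k = Suc K"
  define t where "t = diagonal_entry (bordered_identity v - y) k"
  \<comment> \<open>This choice makes \<open>c t e\<^sub>k\<close> have positive inner product with \<open>v\<close>, namely \<open>|c|\<^sup>2\<close>. The gain of
    \<open>2 |c|\<^sup>2\<close> in the image then exceeds the \<open>|c|\<^sup>2\<close> available in \<open>e\<^sub>0 + c e\<^sub>k\<close>.\<close>
  define c where "c = cnj t * Rep_ell2 v k"
  have "t = 1 - diagonal_entry y k"
    by (simp add: t_def diagonal_entry_def blinfun.diff_left bordered_identity_basis minus_ell2.rep_eq
        basis.rep_eq k_def)
  moreover have "norm (diagonal_entry y k) < 1"
    using norm_diagonal_entry_le[of y k] K[of k] by (simp add: k_def)
  ultimately have "t \<noteq> 0"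
    by auto
  then have "c \<noteq> 0"
    using v[of k] by (simp add: c_def k_def)
  have y0: "blinfun_apply y (basis 0) = 0"
    using y by (simp add: null_diagonal_ideal_def)
  have A: "bordered_identity v - y \<in> border_algebra"
    using complex_vector.subspace_diff[OF _ bordered_identity_border_algebra] y
      operator_algebra_border_algebra null_diagonal_ideal_subset
    by (auto simp: operator_algebra_def)
  have "blinfun_apply (bordered_identity v - y) (basis 0) = v"
    by (simp add: blinfun.diff_left bordered_identity_basis y0)
  moreover have "blinfun_apply (bordered_identity v - y) (basis k) = t *\<^sub>C basis k"
    unfolding t_def by (rule border_algebra_basis[OF A]) (simp add: k_def)
  ultimately have image: "blinfun_apply (bordered_identity v - y) (basis 0 + c *\<^sub>C basis k) = v + (c * t) *\<^sub>C basis k"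
    using border_algebra_bounded_operator[OF A]
    by (simp add: blinfun.add_right operator_scaleC scaleC_scaleC)
  have cc: "c * t * cnj (Rep_ell2 v k) = complex_of_real ((norm c)\<^sup>2)"
    unfolding complex_norm_square by (simp add: c_def)
  have "1 + (norm c * norm t)\<^sup>2 + 2 * (norm c)\<^sup>2 = (norm (v + (c * t) *\<^sub>C basis k))\<^sup>2"
    by (simp add: norm_add_sq cinner_scaleC_right cinner_basis cc norm_scaleC norm_basis norm_mult
        assms(1) del: of_real_power)
  also have "\<dots> \<le> (norm (basis 0 + c *\<^sub>C basis k))\<^sup>2"
    unfolding image[symmetric]
    using norm_blinfun[of "bordered_identity v - y" "basis 0 + c *\<^sub>C basis k"]
      mult_right_mono[OF contraction norm_ge_zero[of "basis 0 + c *\<^sub>C basis k"]]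
    by (intro power_mono) auto
  also have "\<dots> = 1 + (norm c)\<^sup>2"
    by (simp add: norm_add_sq cinner_scaleC_right cinner_basis norm_scaleC norm_basis basis.rep_eq k_def)
  finally show False
    using \<open>c \<noteq> 0\<close> zero_le_power2[of "norm c * norm t"] zero_less_power[of "norm c" 2]
    unfolding zero_less_norm_iff by linarith
qed

lift_definition geometric_vector :: ell2 is
  "\<lambda>k. if k = 0 then 0 else complex_of_real (sqrt ((1/2) ^ k))"
  by (rule summable_comparison_test'[OF summable_geometric[of "1/2 :: real"], of 0]) auto

lemma norm_geometric_vector: "norm geometric_vector = 1"
proof -
  have "(\<lambda>k. (norm (Rep_ell2 geometric_vector (Suc k)))\<^sup>2) sums 1"
    using power_half_series by (simp add: geometric_vector.rep_eq)
  then have "(\<lambda>k. (norm (Rep_ell2 geometric_vector k))\<^sup>2) sums (1 + (norm (Rep_ell2 geometric_vector 0))\<^sup>2)"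
    by (rule sums_Suc)
  then have "(norm geometric_vector)\<^sup>2 = 1"
    unfolding ell2_norm_eq by (simp add: sums_iff geometric_vector.rep_eq)
  then show ?thesis
    unfolding power2_eq_1_iff using norm_ge_zero[of geometric_vector] by linarith
qed

theorem theorem2p3:
  shows "\<exists>(A :: (ell2 \<Rightarrow>\<^sub>L ell2) set) J b.
    unital_operator_algebra A \<and>
    closed_left_ideal A J \<and>
    has_contractive_approximate_identity J \<and>
    b \<in> A \<and>
    \<not> (\<exists>y\<in>J. norm (b - y) = (INF z\<in>J. norm (b - z)))"
proof (intro exI conjI)
  let ?b = "bordered_identity geometric_vector"
  have "(INF z\<in>null_diagonal_ideal. norm (?b - z)) < norm (?b - y)" if "y \<in> null_diagonal_ideal" for y
    using distance_bordered_identity_le[of geometric_vector]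
      norm_bordered_identity_diff_gt[OF norm_geometric_vector _ that]
    by (simp add: norm_geometric_vector geometric_vector.rep_eq)
  then show "\<not> (\<exists>y\<in>null_diagonal_ideal. norm (?b - y) = (INF z\<in>null_diagonal_ideal. norm (?b - z)))"
    by force
qed (rule unital_operator_algebra_border_algebra closed_left_ideal_null_diagonal_ideal
    null_diagonal_ideal_cai bordered_identity_border_algebra)+

end
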